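(* For any function $f$ with $f(x) = \Omega(\log^{10} x)$ and $f(x) = O(x^{0.9})$, there is a dataset $X$ (a finite multiset of points in Euclidean space, in which distinct data points may coincide) with $|X| = \Theta(k)$ and $k = \Theta(f(\phi_X(\mu_X)))$ such that the optimal $k$-means cost is $\phi^* = 0$ and, with probability arbitrarily close to $1$, Algorithm 1 (below) with sampling factor $\ell = k$ needs $\Omega\left(\log(\phi_X(\mu_X)) / \log\log(\phi_X(\mu_X))\right)$ sampling rounds to reach cost $\phi_X(C) = 0$.
   Context: For $x$ and finite nonempty $C$, $d(x,C)=\min_{c\in C}\|x-c\|$; for finite $Y$, $\phi_Y(C)=\sum_{y\in Y} d^2(y,C)$, $\phi_x(C)=\phi_{\{x\}}(C)$, $\phi_Y(c)=\phi_Y(\{c\})$. $\mu_X$ is the centroid of $X$. $\phi^* = \min_{|C|=k}\phi_X(C)$. Algorithm 1 ($k$-means$||$ overseeding) with sampling factor $\ell$: sample $x\in X$ uniformly and set $C=\{x\}$; in each round, include each $x\in X$ independently in $C'$ with probability $\min(1,\ell\phi_x(C)/\phi_X(C))$ and set $C\leftarrow C\cup C'$. *)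

theory Defs
  imports "HOL-Probability.Probability" "HOL-Library.Landau_Symbols"
begin

text \<open>The dimension of the ambient space has to vary with the data set, so points of the
  \<open>n\<close>-dimensional Euclidean space are extensional functions on \<open>{..<n}\<close>. Data sets are multisets
  of such points; centre sets are ordinary sets.\<close>

type_synonym point = "nat \<Rightarrow> real"

definition euclid :: "nat \<Rightarrow> point set" where
  "euclid n = {..<n} \<rightarrow>\<^sub>E UNIV"

definition edist :: "nat \<Rightarrow> point \<Rightarrow> point \<Rightarrow> real" where
  "edist n x y = L2_set (\<lambda>i. x i - y i) {..<n}"

text \<open>Meaningful only for finite nonempty \<open>C\<close>.\<close>

definition set_dist :: "nat \<Rightarrow> point \<Rightarrow> point set \<Rightarrow> real" where
  "set_dist n x C = Min (edist n x ` C)"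

definition cost :: "nat \<Rightarrow> point multiset \<Rightarrow> point set \<Rightarrow> real" where
  "cost n Y C = (\<Sum>y\<in>#Y. (set_dist n y C)\<^sup>2)"

definition centroid :: "nat \<Rightarrow> point multiset \<Rightarrow> point" where
  "centroid n X = (\<lambda>i\<in>{..<n}. (\<Sum>x\<in>#X. x i) / real (size X))"

text \<open>Centres range over the whole space, not just over the data points. The infimum is over a
  nonempty set of nonnegative numbers, and is attained, whenever \<open>n \<ge> 1\<close> and \<open>k \<ge> 1\<close>.\<close>

definition opt_cost :: "nat \<Rightarrow> nat \<Rightarrow> point multiset \<Rightarrow> real" where
  "opt_cost n k X = Inf (cost n X ` {C. C \<subseteq> euclid n \<and> finite C \<and> card C = k})"

text \<open>Coinciding data points are sampled independently of each other, so each copy gets its own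
  coin: \<open>(x, i)\<close> is the \<open>i\<close>-th copy of \<open>x\<close>.\<close>

definition copies :: "point multiset \<Rightarrow> (point \<times> nat) set" where
  "copies X = (SIGMA x:set_mset X. {..<count X x})"

text \<open>Once the cost is \<open>0\<close>, the quotient \<open>0 / 0 = 0\<close> makes every further round leave \<open>C\<close>
  unchanged.\<close>

definition sampling_round ::
    "nat \<Rightarrow> real \<Rightarrow> point multiset \<Rightarrow> point set \<Rightarrow> point set pmf" where
  "sampling_round n l X C =
     map_pmf (\<lambda>\<omega>. C \<union> fst ` {p \<in> copies X. \<omega> p})
       (Pi_pmf (copies X) False
          (\<lambda>(x, i). bernoulli_pmf (min 1 (l * cost n {#x#} C / cost n X C))))"

text \<open>The distribution of the centre set after \<open>t\<close> rounds.\<close>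

primrec overseed ::
    "nat \<Rightarrow> real \<Rightarrow> point multiset \<Rightarrow> nat \<Rightarrow> point set pmf" where
  "overseed n l X 0 = map_pmf (\<lambda>x. {x}) (pmf_of_multiset X)"
| "overseed n l X (Suc t) = bind_pmf (overseed n l X t) (sampling_round n l X)"

end

theory Submission
  imports Defs "HOL-Real_Asymp.Real_Asymp"
begin

text \<open>The data lie on a line: \<open>0\<close> with multiplicity \<open>k\<close>, together with the points \<open>a r\<^sup>j\<close> for
  \<open>j < T\<close>, where \<open>r = 1 / k\<^sup>2\<close> and \<open>T = \<lceil>ln \<Phi>\<rceil>\<close> is negligible compared with \<open>k\<close>. The first centre
  is \<open>0\<close> with probability tending to \<open>1\<close>. As long as the centres are among \<open>0\<close> and the \<open>a r\<^sup>i\<close> with \<open>i < t\<close>, the cost is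
  at least that of \<open>a r\<^sup>t\<close>, namely \<open>(a r\<^sup>t)\<^sup>2\<close>, so each of the points \<open>a r\<^sup>j\<close> with \<open>j > t\<close> is sampled
  with probability at most \<open>k r\<^sup>2\<close>. By a union bound over points and rounds, with high
  probability each of the first \<open>T\<close> rounds adds at most the next point of the sequence, so that \<open>T\<close>
  rounds are necessary.\<close>

definition pt :: "real \<Rightarrow> point" where
  "pt x = (\<lambda>i\<in>{..<1}. x)"

text \<open>The sampling probabilities do not change when all points are scaled by a common positive
  factor. Hence \<open>a\<close> is kept free, to be tuned to a prescribed centroid cost, and
  \<open>r\<close> alone controls the probabilities.\<close>

definition geom_data :: "real \<Rightarrow> real \<Rightarrow> nat \<Rightarrow> nat \<Rightarrow> point multiset" where
  "geom_data a r m T = replicate_mset m (pt 0) + image_mset (\<lambda>j. pt (a * r ^ j)) (mset_set {..<T})"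

text \<open>The invariant after \<open>t\<close> rounds. Only an upper bound on \<open>C\<close> is
  wanted, as a round may well add nothing; the origin must be in \<open>C\<close> because it bounds
  the distance of every other point from above.\<close>

definition covered_prefix :: "real \<Rightarrow> real \<Rightarrow> nat \<Rightarrow> point set \<Rightarrow> bool" where
  "covered_prefix a r t C \<longleftrightarrow> pt 0 \<in> C \<and> C \<subseteq> insert (pt 0) ((\<lambda>j. pt (a * r ^ j)) ` {..<t})"

section \<open>Distances, costs and the optimum\<close>

lemma pt_in_euclid: "pt x \<in> euclid 1"
  by (simp add: pt_def euclid_def)

lemma inj_pt: "inj pt"
proof (rule injI)
  fix x y assume "pt x = pt y"
  then have "pt x 0 = pt y 0" by simp
  then show "x = y" by (simp add: pt_def)
qed

lemma edist_pt: "edist (Suc 0) (pt x) (pt y) = \<bar>x - y\<bar>"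
  by (simp add: edist_def pt_def L2_set_def)

lemma set_dist_nonneg:
  assumes "finite C" "C \<noteq> {}"
  shows "set_dist n x C \<ge> 0"
  unfolding set_dist_def using assms by (intro Min.boundedI) (auto simp: edist_def L2_set_nonneg)

lemma set_dist_le:
  assumes "finite C" "c \<in> C"
  shows "set_dist n x C \<le> edist n x c"
  unfolding set_dist_def using assms by (intro Min_le) auto

lemma set_dist_mem:
  assumes "finite C" "x \<in> C"
  shows "set_dist n x C = 0"
proof (rule antisym)
  show "set_dist n x C \<le> 0"
    using set_dist_le[OF assms, of n x] by (simp add: edist_def L2_set_def)
qed (use assms set_dist_nonneg in auto)

lemma cost_nonneg: "cost n Y C \<ge> 0"
  unfolding cost_def by (induction Y) auto

lemma cost_ge_member:
  assumes "x \<in># Y"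
  shows "(set_dist n x C)\<^sup>2 \<le> cost n Y C"
proof -
  obtain Z where "Y = add_mset x Z" using assms by (meson mset_add)
  then show ?thesis using cost_nonneg[of n Z C] by (simp add: cost_def)
qed

lemma cost_eq_0_if_subset:
  assumes "finite C" "set_mset Y \<subseteq> C"
  shows "cost n Y C = 0"
  using assms by (auto simp: cost_def set_dist_mem subset_iff intro!: sum_mset.neutral)

text \<open>The distinct data points already give cost 0, but exactly \<open>k\<close> centres are
  required, so they are padded with arbitrary further points of the infinite space.\<close>

lemma opt_cost_eq_0:
  assumes "set_mset Y \<subseteq> euclid n" "infinite (euclid n)" "card (set_mset Y) \<le> k"
  shows "opt_cost n k Y = 0"
proof -
  have "infinite (euclid n - set_mset Y)" using assms(2) by simp
  then obtain F where F: "finite F" "card F = k - card (set_mset Y)" "F \<subseteq> euclid n - set_mset Y"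
    using infinite_arbitrarily_large by blast
  have "card (set_mset Y \<union> F) = card (set_mset Y) + card F"
    using F by (intro card_Un_disjoint) auto
  then have "set_mset Y \<union> F \<in> {C. C \<subseteq> euclid n \<and> finite C \<and> card C = k}"
    using F assms by auto
  moreover have "cost n Y (set_mset Y \<union> F) = 0"
    using F(1) by (intro cost_eq_0_if_subset) auto
  ultimately have "0 \<in> cost n Y ` {C. C \<subseteq> euclid n \<and> finite C \<and> card C = k}"
    by (metis image_eqI)
  then show ?thesis
    unfolding opt_cost_def by (rule cInf_eq_minimum) (auto simp: cost_nonneg)
qed

lemma infinite_euclid_1: "infinite (euclid 1)"
proof -
  have "infinite (range pt)" using inj_pt infinite_UNIV_char_0 finite_imageD by blast
  moreover have "range pt \<subseteq> euclid 1" using pt_in_euclid by auto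
  ultimately show ?thesis using finite_subset by blast
qed

section \<open>Size, support and centroid cost of the geometric data\<close>

lemma card_copies: "finite (copies Y)" "card (copies Y) = size Y"
  by (auto simp: copies_def size_multiset_overloaded_eq)

lemma size_geom_data: "size (geom_data a r m T) = m + T"
  by (simp add: geom_data_def)

lemma set_geom_data:
  "m > 0 \<Longrightarrow> set_mset (geom_data a r m T) = insert (pt 0) ((\<lambda>j. pt (a * r ^ j)) ` {..<T})"
  by (auto simp: geom_data_def)

lemma card_set_geom_data:
  assumes "m > 0" shows "card (set_mset (geom_data a r m T)) \<le> Suc T"
  unfolding set_geom_data[OF assms]
  by (rule order.trans[OF card_insert_le_m1]) (auto intro: order.trans[OF card_image_le])

lemma centroid_geom_data:
  "centroid 1 (geom_data a r m T) = pt (a * ((\<Sum>j<T. r ^ j) / real (m + T)))"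
proof -
  have "(\<Sum>x\<in>#geom_data a r m T. x 0) = a * (\<Sum>j<T. r ^ j)"
    by (simp add: geom_data_def pt_def image_mset.compositionality comp_def sum_unfold_sum_mset
        sum_mset_distrib_left)
  then show ?thesis
    by (auto simp: centroid_def pt_def size_geom_data fun_eq_iff)
qed

text \<open>Points and centroid both scale with \<open>a\<close>, and the cost is quadratic in
  distances.\<close>

lemma cost_geom_data_centroid:
  "cost 1 (geom_data a r m T) {centroid 1 (geom_data a r m T)} =
     a\<^sup>2 * cost 1 (geom_data 1 r m T) {centroid 1 (geom_data 1 r m T)}"
proof -
  have "(a * x - a * y)\<^sup>2 = a\<^sup>2 * (x - y)\<^sup>2" for x y :: real
    by (simp add: power2_eq_square algebra_simps)
  \<comment> \<open>The instance at 0 treats the copies of the origin.\<close>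
  note scale = this and scale0 = this[of 0]
  show ?thesis
    unfolding centroid_geom_data
    by (simp add: cost_def set_dist_def geom_data_def edist_pt image_mset.compositionality comp_def
        sum_mset_distrib_left ring_distribs scale scale0[simplified] mult.left_commute
        flip: times_divide_eq_right, simp add: power_divide)
qed

text \<open>The data contain 0 and 1, the latter as the term with exponent 0, and the centroid
  cannot coincide with both.\<close>

lemma cost_geom_data_centroid_pos:
  assumes "m > 0" "T > 0"
  shows "cost 1 (geom_data 1 r m T) {centroid 1 (geom_data 1 r m T)} > 0"
proof -
  obtain z where z: "centroid 1 (geom_data 1 r m T) = pt z"
    using centroid_geom_data by blast
  have "pt 0 \<in># geom_data 1 r m T" "pt 1 \<in># geom_data 1 r m T"
    using assms by (auto simp: set_geom_data intro!: image_eqI[of _ _ 0])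
  from this[THEN cost_ge_member, of 1 "{pt z}"]
  have "z\<^sup>2 \<le> cost 1 (geom_data 1 r m T) {pt z}" "(1 - z)\<^sup>2 \<le> cost 1 (geom_data 1 r m T) {pt z}"
    by (simp_all add: set_dist_def edist_pt)
  moreover have "0 < z\<^sup>2 \<or> 0 < (1 - z)\<^sup>2"
    by (cases "z = 0") auto
  ultimately show ?thesis unfolding z by linarith
qed

text \<open>Lets the data sets be indexed by their centroid cost itself: by quadratic scaling, the
  factor is the square root of the ratio of the desired cost to the cost at
  \<open>a = 1\<close>.\<close>

lemma exists_scale_geom_data:
  assumes "m > 0" "T > 0" "\<Phi> > 0"
  shows "\<exists>a>0. cost 1 (geom_data a r m T) {centroid 1 (geom_data a r m T)} = \<Phi>"
proof -
  define v where "v = cost 1 (geom_data 1 r m T) {centroid 1 (geom_data 1 r m T)}"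
  have "v > 0" unfolding v_def using assms by (intro cost_geom_data_centroid_pos)
  have "cost 1 (geom_data (sqrt (\<Phi> / v)) r m T) {centroid 1 (geom_data (sqrt (\<Phi> / v)) r m T)} =
      (sqrt (\<Phi> / v))\<^sup>2 * v"
    unfolding v_def by (rule cost_geom_data_centroid)
  also have "\<dots> = \<Phi>" using \<open>v > 0\<close> assms by simp
  finally show ?thesis using \<open>v > 0\<close> assms by (intro exI[of _ "sqrt (\<Phi> / v)"]) simp
qed

section \<open>One sampling round under the invariant\<close>

lemma covered_prefix_finite: "covered_prefix a r t C \<Longrightarrow> finite C"
  unfolding covered_prefix_def by (meson finite_imageI finite_insert finite_lessThan finite_subset)

text \<open>The first uncovered point \<open>a * r ^ t\<close> alone pays this much. The origin is
  at distance exactly \<open>a * r ^ t\<close>, and a centre \<open>a * r ^ i\<close> with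
  \<open>i < t\<close> is at least twice as far out, since \<open>r \<le> 1 / 2\<close>.\<close>

lemma covered_prefix_cost_ge:
  assumes "covered_prefix a r t C" "t < T" "m > 0" "a > 0" "0 < r" "r \<le> 1 / 2"
  shows "(a * r ^ t)\<^sup>2 \<le> cost 1 (geom_data a r m T) C"
proof -
  have "a * r ^ t \<le> edist 1 (pt (a * r ^ t)) c" if c: "c \<in> C" for c
  proof -
    consider "c = pt 0" | i where "i < t" "c = pt (a * r ^ i)"
      using assms(1) c unfolding covered_prefix_def by blast
    then show ?thesis
    proof cases
      case 1
      then show ?thesis using assms by (simp add: edist_pt)
    next
      case 2
      then have "r ^ t \<le> r ^ Suc i" using assms by (intro power_decreasing) auto
      also have "\<dots> \<le> r ^ i / 2" using assms by simp
      finally have "a * (2 * r ^ t) \<le> a * r ^ i" using assms by (intro mult_left_mono) auto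
      then show ?thesis using 2 by (simp add: edist_pt)
    qed
  qed
  moreover have "C \<noteq> {}" using assms by (auto simp: covered_prefix_def)
  ultimately have "a * r ^ t \<le> set_dist 1 (pt (a * r ^ t)) C"
    using covered_prefix_finite[OF assms(1)] unfolding set_dist_def by (intro Min.boundedI) auto
  then have "(a * r ^ t)\<^sup>2 \<le> (set_dist 1 (pt (a * r ^ t)) C)\<^sup>2"
    using assms by (intro power_mono) auto
  also have "\<dots> \<le> cost 1 (geom_data a r m T) C"
    using assms by (intro cost_ge_member) (auto simp: set_geom_data)
  finally show ?thesis .
qed

text \<open>Since the origin is a centre, \<open>a * r ^ j\<close> costs at most
  \<open>(a * r ^ (t + 1))^2\<close>, which is \<open>r^2\<close> times the lower bound on the total
  cost.\<close>

lemma sampling_prob_le: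
  assumes "covered_prefix a r t C" "t < j" "t < T" "m > 0" "a > 0" "0 < r" "r \<le> 1 / 2" "l \<ge> 0"
  shows "l * cost 1 {#pt (a * r ^ j)#} C / cost 1 (geom_data a r m T) C \<le> l * r\<^sup>2"
proof -
  have C: "finite C" "pt 0 \<in> C"
    using assms(1) covered_prefix_finite by (auto simp: covered_prefix_def)
  have "set_dist 1 (pt (a * r ^ j)) C \<le> a * r ^ j"
    using set_dist_le[OF C, of 1 "pt (a * r ^ j)"] assms(5,6) by (simp add: edist_pt)
  also have "\<dots> \<le> a * r ^ Suc t"
    using assms by (intro mult_left_mono power_decreasing) auto
  finally have "set_dist 1 (pt (a * r ^ j)) C \<le> (a * r ^ t) * r"
    by (simp only: power_Suc2 mult.assoc)
  then have "(set_dist 1 (pt (a * r ^ j)) C)\<^sup>2 \<le> ((a * r ^ t) * r)\<^sup>2"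
    using C by (intro power_mono set_dist_nonneg) auto
  also have "\<dots> \<le> cost 1 (geom_data a r m T) C * r\<^sup>2"
    unfolding power_mult_distrib[of "a * r ^ t"]
    using assms by (intro mult_right_mono covered_prefix_cost_ge) auto
  finally have "cost 1 {#pt (a * r ^ j)#} C \<le> cost 1 (geom_data a r m T) C * r\<^sup>2"
    by (simp add: cost_def)
  moreover have "cost 1 (geom_data a r m T) C > 0"
    using assms by (intro less_le_trans[OF _ covered_prefix_cost_ge[of a r t]]) auto
  ultimately have "cost 1 {#pt (a * r ^ j)#} C / cost 1 (geom_data a r m T) C \<le> r\<^sup>2"
    by (simp add: divide_le_eq mult.commute)
  from mult_left_mono[OF this assms(8)] show ?thesis by simp
qed

lemma prob_Pi_bernoulli_component:
  assumes "finite A" "x \<in> A" "0 \<le> p x" "p x \<le> 1"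
  shows "measure_pmf.prob (Pi_pmf A False (\<lambda>y. bernoulli_pmf (p y))) {\<omega>. \<omega> x} = p x"
proof -
  have "measure_pmf.prob (Pi_pmf A False (\<lambda>y. bernoulli_pmf (p y))) {\<omega>. \<omega> x} =
      measure_pmf.prob (map_pmf (\<lambda>\<omega>. \<omega> x) (Pi_pmf A False (\<lambda>y. bernoulli_pmf (p y)))) {True}"
    by (simp add: vimage_def)
  also have "\<dots> = p x"
    using assms by (subst Pi_pmf_component) (auto simp: measure_pmf_single)
  finally show ?thesis .
qed

text \<open>The invariant can only break if some copy of a point beyond \<open>a * r ^ t\<close> is
  sampled; a union bound over these copies, collected in \<open>B\<close>, gives the
  estimate.\<close>

lemma sampling_round_prob_le:
  assumes "covered_prefix a r t C" "t < T" "m > 0" "a > 0" "0 < r" "r \<le> 1 / 2" "l \<ge> 0"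
  shows "measure_pmf.prob (sampling_round 1 l (geom_data a r m T) C) {D. \<not> covered_prefix a r (Suc t) D}
           \<le> real (m + T) * (l * r\<^sup>2)"
proof -
  define X where "X = geom_data a r m T"
  define q where "q p = min 1 (l * cost 1 {#fst p#} C / cost 1 X C)" for p :: "point \<times> nat"
  define M where "M = Pi_pmf (copies X) False (\<lambda>p. bernoulli_pmf (q p))"
  define B where "B = {p \<in> copies X. \<exists>j>t. fst p = pt (a * r ^ j)}"
  have finB: "finite B" by (simp add: B_def card_copies)
  have "(\<lambda>(x, i). bernoulli_pmf (min 1 (l * cost 1 {#x#} C / cost 1 X C))) = (\<lambda>p. bernoulli_pmf (q p))"
    by (auto simp: q_def fun_eq_iff)
  then have "measure_pmf.prob (sampling_round 1 l X C) {D. \<not> covered_prefix a r (Suc t) D} =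
      measure_pmf.prob M {\<omega>. \<not> covered_prefix a r (Suc t) (C \<union> fst ` {p \<in> copies X. \<omega> p})}"
    by (simp add: sampling_round_def M_def vimage_def)
  also have "\<dots> \<le> measure_pmf.prob M (\<Union>p\<in>B. {\<omega>. \<omega> p})"
  proof (rule measure_pmf.finite_measure_mono)
    show "{\<omega>. \<not> covered_prefix a r (Suc t) (C \<union> fst ` {p \<in> copies X. \<omega> p})} \<subseteq> (\<Union>p\<in>B. {\<omega>. \<omega> p})"
    proof (intro subsetI, rule ccontr)
      fix \<omega>
      assume "\<omega> \<in> {\<omega>. \<not> covered_prefix a r (Suc t) (C \<union> fst ` {p \<in> copies X. \<omega> p})}"
        and *: "\<omega> \<notin> (\<Union>p\<in>B. {\<omega>. \<omega> p})"
      \<comment> \<open>\<open>C\<close> satisfies the invariant for \<open>t\<close>, so a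
        violation must come from a newly sampled point.\<close>
      then have "\<not> fst ` {p \<in> copies X. \<omega> p} \<subseteq> insert (pt 0) ((\<lambda>j. pt (a * r ^ j)) ` {..<Suc t})"
        using assms(1) by (auto simp: covered_prefix_def lessThan_Suc)
      then obtain p where p: "p \<in> copies X" "\<omega> p"
          "fst p \<notin> insert (pt 0) ((\<lambda>j. pt (a * r ^ j)) ` {..<Suc t})"
        by blast
      have "fst p \<in># X" using p(1) by (auto simp: copies_def)
      then obtain j where j: "fst p = pt (a * r ^ j)"
        using p(3) assms(3) by (auto simp: X_def set_geom_data)
      with p(3) have "j > t" by (auto simp: not_less_eq)
      with p(1) j have "p \<in> B" by (auto simp: B_def simp del: split_paired_Ex)
      with p(2) * show False by blast
    qed
  qed simp
  also have "\<dots> \<le> (\<Sum>p\<in>B. measure_pmf.prob M {\<omega>. \<omega> p})"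
    using finB by (intro measure_pmf.finite_measure_subadditive_finite) auto
  also have "\<dots> \<le> (\<Sum>p\<in>B. l * r\<^sup>2)"
  proof (rule sum_mono)
    fix p assume "p \<in> B"
    then obtain j where j: "p \<in> copies X" "j > t" "fst p = pt (a * r ^ j)" by (auto simp: B_def)
    have "measure_pmf.prob M {\<omega>. \<omega> p} = q p"
      unfolding M_def using j assms by (intro prob_Pi_bernoulli_component)
        (auto simp: card_copies q_def cost_nonneg)
    also have "\<dots> \<le> l * r\<^sup>2"
      using sampling_prob_le[of a r t C j T m l] assms j by (simp add: q_def X_def min.coboundedI2)
    finally show "measure_pmf.prob M {\<omega>. \<omega> p} \<le> l * r\<^sup>2" .
  qed
  also have "\<dots> \<le> real (m + T) * (l * r\<^sup>2)"
  proof -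
    \<comment> \<open>Counting all copies is crude, but affordable for the \<open>r\<close> chosen
      later.\<close>
    have "card B \<le> card (copies X)" by (intro card_mono) (auto simp: B_def card_copies)
    then have "card B \<le> m + T" by (simp add: card_copies X_def size_geom_data)
    then have "real (card B) * (l * r\<^sup>2) \<le> real (m + T) * (l * r\<^sup>2)"
      using assms by (intro mult_right_mono) auto
    then show ?thesis by simp
  qed
  finally show ?thesis by (simp add: X_def)
qed

section \<open>Accumulating the failure probability over the rounds\<close>

lemma prob_bind_pmf_le:
  assumes "\<And>x. x \<notin> A \<Longrightarrow> measure_pmf.prob (q x) B \<le> \<epsilon>" "\<epsilon> \<ge> 0"
  shows "measure_pmf.prob (bind_pmf p q) B \<le> measure_pmf.prob p A + \<epsilon>"
proof -
  have "emeasure (bind_pmf p q) B = (\<integral>\<^sup>+x. emeasure (q x) B \<partial>p)" by simp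
  \<comment> \<open>First-stage outcomes in \<open>A\<close> are charged 1, all others
    \<epsilon>.\<close>
  also have "\<dots> \<le> (\<integral>\<^sup>+x. indicator A x + ennreal \<epsilon> \<partial>p)"
  proof (rule nn_integral_mono)
    fix x
    show "emeasure (q x) B \<le> indicator A x + ennreal \<epsilon>"
    proof (cases "x \<in> A")
      case True
      then show ?thesis
        by (auto intro: order.trans[OF measure_pmf.emeasure_le_1])
    next
      case False
      then show ?thesis
        using assms by (simp add: measure_pmf.emeasure_eq_measure)
    qed
  qed
  also have "\<dots> = emeasure p A + ennreal \<epsilon>"
    by (subst nn_integral_add) auto
  finally show ?thesis
    using assms(2) by (simp add: measure_pmf.emeasure_eq_measure flip: ennreal_plus)
qed

text \<open>For \<open>t = 0\<close> the invariant says \<open>C = {pt 0}\<close>, and the origin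
  fills at least \<open>m\<close> of the \<open>m + T\<close> equally likely positions.\<close>

lemma first_centre_prob_le:
  assumes "m > 0"
  shows "measure_pmf.prob (overseed 1 l (geom_data a r m T) 0) {C. \<not> covered_prefix a r 0 C}
           \<le> real T / real (m + T)"
proof -
  define X where "X = geom_data a r m T"
  have X: "X \<noteq> {#}" "size X = m + T"
    using assms by (auto simp: X_def size_geom_data simp flip: size_eq_0_iff_empty)
  have "measure_pmf.prob (overseed 1 l X 0) {C. \<not> covered_prefix a r 0 C} =
      measure_pmf.prob (pmf_of_multiset X) (- {pt 0})"
    by (auto simp: covered_prefix_def vimage_def intro!: arg_cong[of _ _ "measure_pmf.prob _"])
  also have "\<dots> = 1 - pmf (pmf_of_multiset X) (pt 0)"
    using measure_pmf.prob_compl[of "{pt 0}" "pmf_of_multiset X"]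
    by (simp add: Compl_eq_Diff_UNIV measure_pmf_single)
  also have "pmf (pmf_of_multiset X) (pt 0) = real (count X (pt 0)) / real (m + T)"
    using X by simp
  \<comment> \<open>Only an inequality, since for arbitrary \<open>a\<close> and \<open>r\<close>
    some \<open>a * r ^ j\<close> may also be 0.\<close>
  also have "real m \<le> real (count X (pt 0))"
    by (simp add: X_def geom_data_def)
  then have "1 - real (count X (pt 0)) / real (m + T) \<le> real T / real (m + T)"
    using assms by (simp add: divide_simps)
  finally show ?thesis by (simp add: X_def)
qed

text \<open>Induction over rounds; \<open>t \<le> T\<close> ensures that every round starts with an
  uncovered point left, as the bound for a single round demands.\<close>

lemma overseed_prob_le:
  assumes "t \<le> T" "m > 0" "a > 0" "0 < r" "r \<le> 1 / 2" "l \<ge> 0"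
  shows "measure_pmf.prob (overseed 1 l (geom_data a r m T) t) {C. \<not> covered_prefix a r t C}
           \<le> real T / real (m + T) + real t * (real (m + T) * (l * r\<^sup>2))"
  using assms(1)
proof (induction t)
  case 0
  then show ?case using first_centre_prob_le[OF assms(2)] by simp
next
  case (Suc t)
  have "measure_pmf.prob (overseed 1 l (geom_data a r m T) (Suc t)) {C. \<not> covered_prefix a r (Suc t) C}
      \<le> measure_pmf.prob (overseed 1 l (geom_data a r m T) t) {C. \<not> covered_prefix a r t C}
        + real (m + T) * (l * r\<^sup>2)"
    unfolding overseed.simps
    using Suc.prems assms by (intro prob_bind_pmf_le sampling_round_prob_le) auto
  with Suc show ?case by (simp add: algebra_simps)
qed

text \<open>With \<open>l = m = k\<close> and \<open>r = 1 / k^2\<close>, a round fails with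
  probability at most \<open>2 k * k / k^4 = 2 / k^2\<close>, so even \<open>T\<close> rounds add
  little to the loss \<open>T / k\<close> from the first centre.\<close>

lemma overseed_nonzero_cost_prob:
  assumes "t < T" "T \<le> k" "2 \<le> k" "a > 0" "r = 1 / (real k)\<^sup>2"
  shows "measure_pmf.prob (overseed 1 (real k) (geom_data a r k T) t)
           {C. cost 1 (geom_data a r k T) C \<noteq> 0} \<ge> 1 - 3 * real T / real k"
proof -
  have "(2::real)\<^sup>2 \<le> (real k)\<^sup>2" using assms by (intro power_mono) auto
  then have r: "0 < r" "r \<le> 1 / 2" unfolding assms(5) using assms(3) by (auto simp: field_simps)
  let ?M = "overseed 1 (real k) (geom_data a r k T) t"
  have "1 - measure_pmf.prob ?M {C. cost 1 (geom_data a r k T) C \<noteq> 0} =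
      measure_pmf.prob ?M {C. cost 1 (geom_data a r k T) C = 0}"
    by (subst measure_pmf.prob_compl[symmetric]) (auto intro!: arg_cong[of _ _ "measure_pmf.prob _"])
  \<comment> \<open>Cost 0 contradicts the invariant: as \<open>t < T\<close>, the point
    \<open>a * r ^ t\<close> still pays.\<close>
  also have "\<dots> \<le> measure_pmf.prob ?M {C. \<not> covered_prefix a r t C}"
  proof (rule measure_pmf.finite_measure_mono)
    show "{C. cost 1 (geom_data a r k T) C = 0} \<subseteq> {C. \<not> covered_prefix a r t C}"
    proof clarify
      fix C assume C: "cost 1 (geom_data a r k T) C = 0" "covered_prefix a r t C"
      have "(a * r ^ t)\<^sup>2 \<le> 0"
        using covered_prefix_cost_ge[OF C(2), of T k] C(1) assms r by simp
      then show False using assms r by auto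
    qed
  qed simp
  also have "\<dots> \<le> real T / real (k + T) + real t * (real (k + T) * (real k * r\<^sup>2))"
    using assms r by (intro overseed_prob_le) auto
  also have "\<dots> \<le> real T / real k + real T * (2 / real k)"
  proof (rule add_mono)
    show "real T / real (k + T) \<le> real T / real k"
      using assms by (intro divide_left_mono) auto
    have "real (k + T) * (real k * r\<^sup>2) \<le> (2 * real k) * (real k * r\<^sup>2)"
      using assms by (intro mult_right_mono) auto
    also have "\<dots> = 2 / (real k)\<^sup>2"
      unfolding assms(5) using assms(3) by (simp add: field_simps power2_eq_square)
    \<comment> \<open>Weakened so that both error terms become multiples of \<open>T / k\<close>,
      with sum \<open>3 T / k\<close>.\<close>
    also have "\<dots> \<le> 2 / real k"
      using assms by (intro divide_left_mono) (auto simp: power2_eq_square)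
    finally have "real (k + T) * (real k * r\<^sup>2) \<le> 2 / real k" .
    then show "real t * (real (k + T) * (real k * r\<^sup>2)) \<le> real T * (2 / real k)"
      using assms by (intro mult_mono) auto
  qed
  finally show ?thesis by simp
qed

section \<open>Choice of parameters and asymptotics\<close>

theorem theorem4:
  fixes f :: "real \<Rightarrow> real"
  assumes "f \<in> \<Omega>(\<lambda>x. ln x ^ 10)"
    and "f \<in> O(\<lambda>x. x powr 0.9)"
  shows "\<exists>(n :: real \<Rightarrow> nat) (X :: real \<Rightarrow> point multiset) (k :: real \<Rightarrow> nat).
      (\<forall>\<^sub>F \<Phi> in at_top.
         set_mset (X \<Phi>) \<subseteq> euclid (n \<Phi>) \<and>
         cost (n \<Phi>) (X \<Phi>) {centroid (n \<Phi>) (X \<Phi>)} = \<Phi> \<and>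
         opt_cost (n \<Phi>) (k \<Phi>) (X \<Phi>) = 0) \<and>
      (\<lambda>\<Phi>. real (size (X \<Phi>))) \<in> \<Theta>(\<lambda>\<Phi>. real (k \<Phi>)) \<and>
      (\<lambda>\<Phi>. real (k \<Phi>)) \<in> \<Theta>(f) \<and>
      (\<exists>c>0. \<forall>\<delta>>0. \<forall>\<^sub>F \<Phi> in at_top.
         \<forall>t::nat. real t < c * (ln \<Phi> / ln (ln \<Phi>)) \<longrightarrow>
           measure_pmf.prob (overseed (n \<Phi>) (real (k \<Phi>)) (X \<Phi>) t)
             {C. cost (n \<Phi>) (X \<Phi>) C \<noteq> 0} \<ge> 1 - \<delta>)"
proof -
  \<comment> \<open>The absolute value is taken because Landau symbols do not fix the sign of
    \<open>f\<close>.\<close>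
  define k where "k \<Phi> = nat \<lceil>\<bar>f \<Phi>\<bar>\<rceil>" for \<Phi>
  define T where "T \<Phi> = nat \<lceil>ln \<Phi>\<rceil>" for \<Phi> :: real
  define r where "r \<Phi> = 1 / (real (k \<Phi>))\<^sup>2" for \<Phi>
  define a where "a \<Phi> = (SOME a. a > 0 \<and> cost 1 (geom_data a (r \<Phi>) (k \<Phi>) (T \<Phi>))
      {centroid 1 (geom_data a (r \<Phi>) (k \<Phi>) (T \<Phi>))} = \<Phi>)" for \<Phi>
  define X where "X \<Phi> = geom_data (a \<Phi>) (r \<Phi>) (k \<Phi>) (T \<Phi>)" for \<Phi>
  obtain b where b: "b > 0" "\<forall>\<^sub>F \<Phi> in at_top. b * \<bar>ln \<Phi> ^ 10\<bar> \<le> \<bar>f \<Phi>\<bar>"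
    using assms(1) by (auto elim!: landau_omega.bigE simp: abs_mult)
  have k_ge: "\<bar>f \<Phi>\<bar> \<le> real (k \<Phi>)" "real (k \<Phi>) \<le> \<bar>f \<Phi>\<bar> + 1" for \<Phi>
    unfolding k_def by linarith+
  \<comment> \<open>\<open>T\<close> is negligible against \<open>f\<close>, because
    \<open>ln^10\<close> beats every multiple of \<open>ln\<close>. Taking \<epsilon> = 1 gives
    \<open>T + 2 \<le> k\<close>; the value \<open>3 / \<delta>\<close> will control the failure
    probability.\<close>
  have T_le: "\<forall>\<^sub>F \<Phi> in at_top. \<epsilon> * real (T \<Phi>) + 2 \<le> \<bar>f \<Phi>\<bar>" if "\<epsilon> > 0" for \<epsilon>
  proof -
    have "\<forall>\<^sub>F \<Phi> in at_top. \<epsilon> * (ln \<Phi> + 1) + 2 \<le> b * \<bar>ln \<Phi> ^ 10\<bar>"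
      using b(1) that by real_asymp
    moreover have "\<forall>\<^sub>F \<Phi>::real in at_top. ln \<Phi> > 0" by real_asymp
    ultimately show ?thesis using b(2)
    proof eventually_elim
      case (elim \<Phi>)
      have "real (T \<Phi>) \<le> ln \<Phi> + 1" using elim unfolding T_def by linarith
      then have "\<epsilon> * real (T \<Phi>) \<le> \<epsilon> * (ln \<Phi> + 1)" using that by simp
      with elim show ?case by linarith
    qed
  qed
  have T_pos: "\<forall>\<^sub>F \<Phi> in at_top. T \<Phi> > 0"
    unfolding T_def by (rule eventually_mono[OF eventually_gt_at_top[of 1]]) auto
  have a: "\<forall>\<^sub>F \<Phi> in at_top. a \<Phi> > 0 \<and> cost 1 (X \<Phi>) {centroid 1 (X \<Phi>)} = \<Phi>"
    using T_pos T_le[OF zero_less_one] eventually_gt_at_top[of 0]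
  proof eventually_elim
    case (elim \<Phi>)
    then have "k \<Phi> > 0" using k_ge[of \<Phi>] by linarith
    from exists_scale_geom_data[OF this elim(1,3), of "r \<Phi>"] show ?case
      unfolding a_def X_def by (rule someI_ex)
  qed
  have 1: "\<forall>\<^sub>F \<Phi> in at_top. set_mset (X \<Phi>) \<subseteq> euclid 1 \<and>
      cost 1 (X \<Phi>) {centroid 1 (X \<Phi>)} = \<Phi> \<and> opt_cost 1 (k \<Phi>) (X \<Phi>) = 0"
    using a T_le[OF zero_less_one]
  proof eventually_elim
    case (elim \<Phi>)
    \<comment> \<open>The origin and the \<open>T\<close> sequence points give at most
      \<open>T + 1\<close> distinct points, which \<open>k\<close> centres can cover.\<close>
    then have k: "k \<Phi> > 0" "Suc (T \<Phi>) \<le> k \<Phi>" using k_ge[of \<Phi>] by linarith+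
    have sub: "set_mset (X \<Phi>) \<subseteq> euclid 1"
      unfolding X_def set_geom_data[OF k(1)] using pt_in_euclid by auto
    have "card (set_mset (X \<Phi>)) \<le> k \<Phi>"
      unfolding X_def using card_set_geom_data[OF k(1)] k(2) by (rule order.trans)
    with opt_cost_eq_0[OF sub infinite_euclid_1] sub elim show ?case by blast
  qed
  have 2: "(\<lambda>\<Phi>. real (size (X \<Phi>))) \<in> \<Theta>(\<lambda>\<Phi>. real (k \<Phi>))"
  proof (rule bigthetaI')
    show "\<forall>\<^sub>F \<Phi> in at_top. 1 * norm (real (k \<Phi>)) \<le> norm (real (size (X \<Phi>))) \<and>
        norm (real (size (X \<Phi>))) \<le> 2 * norm (real (k \<Phi>))"
      using T_le[OF zero_less_one]
    proof eventually_elim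
      case (elim \<Phi>)
      then show ?case using k_ge[of \<Phi>] by (simp add: X_def size_geom_data)
    qed
  qed auto
  have 3: "(\<lambda>\<Phi>. real (k \<Phi>)) \<in> \<Theta>(f)"
  proof (rule bigthetaI')
    \<comment> \<open>Rounding up adds at most 1, which is absorbed as eventually
      \<open>\<bar>f \<Phi>\<bar> \<ge> 2\<close>.\<close>
    show "\<forall>\<^sub>F \<Phi> in at_top. 1 * norm (f \<Phi>) \<le> norm (real (k \<Phi>)) \<and>
        norm (real (k \<Phi>)) \<le> 2 * norm (f \<Phi>)"
      using T_le[OF zero_less_one]
    proof eventually_elim
      case (elim \<Phi>)
      then show ?case using k_ge[of \<Phi>] by simp
    qed
  qed auto
  have 4: "\<forall>\<^sub>F \<Phi> in at_top. \<forall>t::nat. real t < 1 * (ln \<Phi> / ln (ln \<Phi>)) \<longrightarrow>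
      measure_pmf.prob (overseed 1 (real (k \<Phi>)) (X \<Phi>) t) {C. cost 1 (X \<Phi>) C \<noteq> 0} \<ge> 1 - \<delta>"
    if "\<delta> > 0" for \<delta>
  proof -
    \<comment> \<open>Chosen to turn the failure bound \<open>3 T / k\<close> into at most
      \<delta>.\<close>
    have "3 / \<delta> > 0" using that by simp
    note T_le_\<delta> = T_le[OF this]
    \<comment> \<open>The claimed number of rounds is thus at most
      \<open>ln \<Phi> \<le> T \<Phi>\<close>, so the constant \<open>c = 1\<close> works.\<close>
    have "\<forall>\<^sub>F \<Phi>::real in at_top. ln \<Phi> / ln (ln \<Phi>) \<le> ln \<Phi>" by real_asymp
    then show ?thesis using a T_le[OF zero_less_one] T_le_\<delta>
    proof eventually_elim
      case (elim \<Phi>)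
      have k: "T \<Phi> \<le> k \<Phi>" "2 \<le> k \<Phi>" using elim k_ge[of \<Phi>] by linarith+
      have "3 / \<delta> * real (T \<Phi>) \<le> real (k \<Phi>)" using elim k_ge[of \<Phi>] by linarith
      then have \<delta>: "3 * real (T \<Phi>) / real (k \<Phi>) \<le> \<delta>"
        using that k by (simp add: field_simps)
      show ?case
      proof (intro allI impI)
        fix t :: nat
        assume "real t < 1 * (ln \<Phi> / ln (ln \<Phi>))"
        then have "t < T \<Phi>" using elim unfolding T_def by linarith
        from overseed_nonzero_cost_prob[OF this k _ r_def, of "a \<Phi>"] elim \<delta>
        show "measure_pmf.prob (overseed 1 (real (k \<Phi>)) (X \<Phi>) t) {C. cost 1 (X \<Phi>) C \<noteq> 0} \<ge> 1 - \<delta>"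
          unfolding X_def by linarith
      qed
    qed
  qed
  show ?thesis
    by (rule exI[of _ "\<lambda>_. 1"], rule exI[of _ X], rule exI[of _ k])
       (use 1 2 3 4 in \<open>auto intro!: exI[of _ "1::real"]\<close>)
qed

end
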